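(* Let $p\in[1,\infty]$ and let $X,Y$ be compact $p$-metric spaces. Then $$d_{\mathrm{GH}}^{(p)}(X,Y)=\inf_{Z}\,d_{\mathrm{H}}^Z\left(\varphi_X(X),\varphi_Y(Y)\right),$$ where the infimum is taken over all compact $p$-metric spaces $Z$ and all isometric embeddings $\varphi_X:X\hookrightarrow Z$ and $\varphi_Y:Y\hookrightarrow Z$.
   Context: All metric spaces are nonempty. For $a,b\ge 0$: $a\boxplus_p b=(a^p+b^p)^{1/p}$ for $p\in[1,\infty)$ and $a\boxplus_\infty b=\max(a,b)$. A $p$-metric space is a metric space satisfying $d(x,x'')\le d(x,x')\boxplus_p d(x',x'')$ for all points (for $p=\infty$: an ultrametric space). For $a,b\ge0$: $\Lambda_p(a,b)=|a^p-b^p|^{1/p}$ for $p\in[1,\infty)$; $\Lambda_\infty(a,b)=\max(a,b)$ if $a\ne b$ and $0$ if $a=b$. For metric spaces $X,Y$, $$d_{\mathrm{GH}}^{(p)}(X,Y)=2^{-\frac1p}\inf_R\ \sup_{(x,y),(x',y')\in R}\Lambda_p(d_X(x,x'),d_Y(y,y')),$$ with $R$ ranging over all correspondences between $X$ and $Y$ (subsets of $X\times Y$ projecting onto both factors) and the convention $\frac1\infty=0$. An isometric embedding is a distance-preserving map. $d_{\mathrm{H}}^Z$ is the Hausdorff distance between subsets of $Z$. *)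

theory Defs
  imports "HOL-Analysis.Analysis"
begin

text \<open>
  The exponent ranges over \<^typ>\<open>ennreal\<close>, with \<open>\<infinity>\<close> as a possible value;
  the definitions below are only meaningful for \<open>1 \<le> p\<close>.
\<close>

definition p_sum :: "ennreal \<Rightarrow> real \<Rightarrow> real \<Rightarrow> real" where
  "p_sum p a b = (if p = \<infinity> then max a b
     else (a powr enn2real p + b powr enn2real p) powr (1 / enn2real p))"

definition p_diff :: "ennreal \<Rightarrow> real \<Rightarrow> real \<Rightarrow> real" where
  "p_diff p a b = (if p = \<infinity> then (if a = b then 0 else max a b)
     else \<bar>a powr enn2real p - b powr enn2real p\<bar> powr (1 / enn2real p))"

definition p_metric_space :: "ennreal \<Rightarrow> 'a metric \<Rightarrow> bool" where
  "p_metric_space p X \<longleftrightarrow> mspace X \<noteq> {} \<and>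
     (\<forall>x\<in>mspace X. \<forall>x'\<in>mspace X. \<forall>x''\<in>mspace X.
        mdist X x x'' \<le> p_sum p (mdist X x x') (mdist X x' x''))"

definition compact_p_metric_space :: "ennreal \<Rightarrow> 'a metric \<Rightarrow> bool" where
  "compact_p_metric_space p X \<longleftrightarrow> p_metric_space p X \<and> compact_space (mtopology_of X)"

definition correspondences :: "'a metric \<Rightarrow> 'b metric \<Rightarrow> ('a \<times> 'b) set set" where
  "correspondences X Y =
     {R. R \<subseteq> mspace X \<times> mspace Y \<and> fst ` R = mspace X \<and> snd ` R = mspace Y}"

text \<open>
  Both distances take values in \<^typ>\<open>ennreal\<close>, so that all suprema and infima are
  the true ones, also for unbounded spaces.
\<close>

definition GH_dist :: "ennreal \<Rightarrow> 'a metric \<Rightarrow> 'b metric \<Rightarrow> ennreal" where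
  "GH_dist p X Y =
     ennreal (2 powr (- (if p = \<infinity> then 0 else 1 / enn2real p))) *
     (INF R \<in> correspondences X Y. SUP (x, y) \<in> R. SUP (x', y') \<in> R.
        ennreal (p_diff p (mdist X x x') (mdist Y y y')))"

definition hausdorff_dist :: "'a metric \<Rightarrow> 'a set \<Rightarrow> 'a set \<Rightarrow> ennreal" where
  "hausdorff_dist Z A B =
     max (SUP a \<in> A. INF b \<in> B. ennreal (mdist Z a b))
         (SUP b \<in> B. INF a \<in> A. ennreal (mdist Z a b))"

definition isometric_embedding :: "'a metric \<Rightarrow> 'b metric \<Rightarrow> ('a \<Rightarrow> 'b) \<Rightarrow> bool" where
  "isometric_embedding X Z f \<longleftrightarrow> f \<in> mspace X \<rightarrow> mspace Z \<and>
     (\<forall>x\<in>mspace X. \<forall>x'\<in>mspace X. mdist Z (f x) (f x') = mdist X x x')"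

text \<open>
  HOL cannot quantify over all types inside a term, so the points of the ambient space are
  taken from a type, which is required to have the form \<open>'a + 'b + 'z\<close>. The
  summand \<open>'z\<close> is arbitrary: every metric space on a type \<open>'z\<close> has an isometric copy
  among the spaces considered here, so a statement for all \<open>'z\<close> speaks about all ambient
  spaces. The summands \<open>'a\<close> and \<open>'b\<close> only guarantee that the type is large enough to
  carry the union of a copy of \<open>X\<close> and a copy of \<open>Y\<close>; on a type that is too small
  (for instance a finite one) there need not be any ambient space at all.
\<close>

definition common_embeddings ::
    "ennreal \<Rightarrow> 'a metric \<Rightarrow> 'b metric \<Rightarrow>
     (('a + 'b + 'z) metric \<times> ('a \<Rightarrow> 'a + 'b + 'z) \<times> ('b \<Rightarrow> 'a + 'b + 'z)) set" where
  "common_embeddings p X Y =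
     {(Z, f, g). compact_p_metric_space p Z \<and>
        isometric_embedding X Z f \<and> isometric_embedding Y Z g}"

end

theory Submission
  imports Defs
begin

text \<open>
  For \<open>\<delta> \<ge> 0\<close>, the inequality \<open>2 powr (-1/p) * \<Lambda>(a, b) \<le> \<delta>\<close> says exactly that
  \<open>a \<le> b \<boxplus> \<delta> \<boxplus> \<delta>\<close> and \<open>b \<le> a \<boxplus> \<delta> \<boxplus> \<delta>\<close>, which treats finite and infinite \<open>p\<close> alike.
  If the images of \<open>X\<close> and \<open>Y\<close> have Hausdorff distance below \<open>\<delta>\<close>, the pairs of points
  whose images are at distance at most \<open>\<delta>\<close> form a correspondence, and the triangle inequality of the
  ambient space bounds its distortion. Conversely, given a correspondence \<open>R\<close> of distortion at
  most \<open>\<delta> > 0\<close> in this sense, glue \<open>X\<close> and \<open>Y\<close> along bridges of length \<open>\<delta>\<close>: put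
  \<open>d(x, y) = inf {d(x, x') \<boxplus> \<delta> \<boxplus> d(y', y) | (x', y') \<in> R}\<close>. The distortion bound is what makes this
  a \<open>p\<close>-metric on the disjoint union; it is compact, and each point has a partner at distance at most \<open>\<delta>\<close>.
\<close>

section \<open>Arithmetic of the operation \<open>p_sum\<close>\<close>

lemma p_sum_commute: "p_sum p a b = p_sum p b a"
  by (simp add: p_sum_def max.commute add.commute)

lemma p_sum_nonneg [simp]: "0 \<le> a \<Longrightarrow> 0 \<le> p_sum p a b"
  by (auto simp: p_sum_def)

lemma enn2real_ge_1:
  assumes "1 \<le> p" "p \<noteq> \<infinity>"
  shows "1 \<le> enn2real p"
  using enn2real_mono[OF assms(1)] assms(2) by (simp add: top.not_eq_extremum)

lemma p_sum_powr:
  assumes "1 \<le> p" "p \<noteq> \<infinity>"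
  shows "p_sum p a b powr enn2real p = a powr enn2real p + b powr enn2real p"
  using enn2real_ge_1[OF assms] assms(2) by (simp add: p_sum_def powr_powr add_nonneg_nonneg)

lemma p_sum_assoc:
  assumes "1 \<le> p"
  shows "p_sum p (p_sum p a b) c = p_sum p a (p_sum p b c)"
proof (cases "p = \<infinity>")
  case True
  then show ?thesis by (simp add: p_sum_def max.assoc)
next
  case False
  then show ?thesis
    using p_sum_powr[OF assms False] by (simp add: p_sum_def[of p "p_sum p a b"] p_sum_def[of p a "p_sum p b c"] add.assoc)
qed

lemma p_sum_left_commute:
  assumes "1 \<le> p"
  shows "p_sum p a (p_sum p b c) = p_sum p b (p_sum p a c)"
  by (metis assms p_sum_assoc p_sum_commute)

lemma p_sum_mono:
  assumes "1 \<le> p" "0 \<le> a" "a \<le> a'" "0 \<le> b" "b \<le> b'"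
  shows "p_sum p a b \<le> p_sum p a' b'"
proof (cases "p = \<infinity>")
  case True
  then show ?thesis using assms by (auto simp: p_sum_def)
next
  case False
  with enn2real_ge_1[OF assms(1) False] assms show ?thesis
    by (auto simp: p_sum_def intro!: powr_mono2 add_mono)
qed

lemma p_sum_0_right:
  assumes "1 \<le> p" "0 \<le> a"
  shows "p_sum p a 0 = a"
  using assms enn2real_ge_1[OF assms(1)] by (auto simp: p_sum_def powr_powr)

lemma p_sum_ge_left:
  assumes "1 \<le> p" "0 \<le> a" "0 \<le> b"
  shows "a \<le> p_sum p a b"
  using p_sum_mono[of p a a 0 b] assms by (simp add: p_sum_0_right)

text \<open>After division by \<open>s = a + b\<close> both terms lie in the unit interval, where
  the q-th power is below the identity; hence \<open>a powr q + b powr q\<close> is at most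
  \<open>s powr q\<close>. This turns the p-triangle inequality into the ordinary one.\<close>

lemma p_sum_le_add:
  assumes "1 \<le> p" "0 \<le> a" "0 \<le> b"
  shows "p_sum p a b \<le> a + b"
proof (cases "p = \<infinity>")
  case True
  then show ?thesis using assms by (auto simp: p_sum_def)
next
  case False
  define q where "q = enn2real p"
  have q: "1 \<le> q" using enn2real_ge_1[OF assms(1) False] by (simp add: q_def)
  have "a powr q + b powr q \<le> (a + b) powr q"
  proof (cases "a + b = 0")
    case True
    with assms have "a = 0" "b = 0" by auto
    then show ?thesis by simp
  next
    case False
    define s where "s = a + b"
    have s: "0 < s" using False assms by (simp add: s_def)
    have le: "x powr q \<le> x / s * s powr q" if "0 \<le> x" "x \<le> s" for x
    proof -
      have "(x / s) powr q \<le> (x / s) powr 1"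
        using that s q by (intro powr_mono') auto
      then show ?thesis using that s by (simp add: powr_divide field_simps)
    qed
    have "a powr q + b powr q \<le> a / s * s powr q + b / s * s powr q"
      using le[of a] le[of b] assms by (simp add: s_def)
    also have "\<dots> = (a + b) / s * s powr q" by (simp add: add_divide_distrib distrib_right)
    also have "\<dots> = s powr q" using s by (simp add: s_def)
    finally show ?thesis by (simp add: s_def)
  qed
  then have "(a powr q + b powr q) powr (1 / q) \<le> ((a + b) powr q) powr (1 / q)"
    using q by (intro powr_mono2) auto
  also have "\<dots> = a + b" using q assms by (simp add: powr_powr)
  finally show ?thesis using False by (simp add: p_sum_def q_def)
qed

lemma continuous_on_p_sum:
  assumes "1 \<le> p" "0 \<le> a"
  shows "continuous_on {0..} (p_sum p a)"
proof (cases "p = \<infinity>")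
  case True
  then show ?thesis by (auto simp: p_sum_def[abs_def] intro!: continuous_intros)
next
  case False
  with enn2real_ge_1[OF assms(1) False] assms show ?thesis
    by (auto simp: p_sum_def[abs_def] intro!: continuous_intros continuous_on_powr')
qed

text \<open>The infimum lies in the closure of \<open>S\<close>, and a lower bound for a continuous
  function on \<open>S\<close> persists on the closure. Since bridges are infima, this allows their
  triangle inequalities to be checked for one pair of the correspondence at a time.\<close>

lemma le_p_sum_Inf:
  assumes "1 \<le> p" "0 \<le> a" "S \<noteq> {}" "\<And>s. s \<in> S \<Longrightarrow> 0 \<le> s" "\<And>s. s \<in> S \<Longrightarrow> c \<le> p_sum p a s"
  shows "c \<le> p_sum p a (Inf S)"
proof -
  have bdd: "bdd_below S" using assms(4) by (meson bdd_belowI)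
  have cl: "closure S \<subseteq> {0..}"
    by (rule closure_minimal) (use assms(4) in auto)
  show ?thesis
    using closure_contains_Inf[OF assms(3) bdd] continuous_on_subset[OF continuous_on_p_sum[OF assms(1,2)] cl]
      assms(5)
    by (metis continuous_ge_on_closure)
qed

section \<open>The normalised distortion and its relation to \<open>GH_dist\<close>\<close>

definition p_factor :: "ennreal \<Rightarrow> real" where
  "p_factor p = 2 powr (- (if p = \<infinity> then 0 else 1 / enn2real p))"

lemma p_factor_pos: "0 < p_factor p"
  by (simp add: p_factor_def)

text \<open>For finite p, q-th powers turn the left side into
  \<open>\<bar>a powr q - b powr q\<bar> \<le> 2 * \<delta> powr q\<close>, whose two halves are the
  inequalities on the right. For infinite p, both sides say that \<open>a = b\<close> or both
  numbers are at most \<delta>.\<close>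

lemma p_factor_p_diff_le_iff:
  assumes "1 \<le> p" "0 \<le> a" "0 \<le> b" "0 \<le> \<delta>"
  shows "p_factor p * p_diff p a b \<le> \<delta> \<longleftrightarrow>
    a \<le> p_sum p b (p_sum p \<delta> \<delta>) \<and> b \<le> p_sum p a (p_sum p \<delta> \<delta>)"
proof (cases "p = \<infinity>")
  case True
  then show ?thesis using assms by (auto simp: p_factor_def p_diff_def p_sum_def)
next
  case False
  define q where "q = enn2real p"
  have q: "1 \<le> q" using enn2real_ge_1[OF assms(1) False] by (simp add: q_def)
  have mono: "x \<le> y \<longleftrightarrow> x powr q \<le> y powr q" if "0 \<le> x" "0 \<le> y" for x y
    using that q powr_mono2[of q x y] powr_less_mono2[of q y x] by force
  have sum: "p_sum p x y powr q = x powr q + y powr q" for x y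
    using p_sum_powr[OF assms(1) False] by (simp add: q_def)
  have "(p_factor p * p_diff p a b) powr q = \<bar>a powr q - b powr q\<bar> / 2"
    using False q by (simp add: p_factor_def p_diff_def q_def[symmetric] powr_mult powr_powr powr_divide powr_minus_divide)
  moreover have "0 \<le> p_factor p * p_diff p a b"
    using False by (simp add: p_factor_def p_diff_def)
  ultimately have "p_factor p * p_diff p a b \<le> \<delta> \<longleftrightarrow> \<bar>a powr q - b powr q\<bar> / 2 \<le> \<delta> powr q"
    using mono[of "p_factor p * p_diff p a b" \<delta>] assms by (simp only:)
  then show ?thesis
    using mono[of a "p_sum p b (p_sum p \<delta> \<delta>)"] mono[of b "p_sum p a (p_sum p \<delta> \<delta>)"] assms
    by (auto simp: sum)
qed

lemma GH_dist_le:
  assumes "R \<in> correspondences X Y"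
    and "\<And>x y x' y'. (x, y) \<in> R \<Longrightarrow> (x', y') \<in> R \<Longrightarrow>
      p_factor p * p_diff p (mdist X x x') (mdist Y y y') \<le> \<delta>"
  shows "GH_dist p X Y \<le> ennreal \<delta>"
proof -
  let ?D = "\<lambda>R. SUP (x, y) \<in> R. SUP (x', y') \<in> R. ennreal (p_diff p (mdist X x x') (mdist Y y y'))"
  have "?D R \<le> ennreal (\<delta> / p_factor p)"
    using assms(2) p_factor_pos[of p] by (fastforce intro!: SUP_least ennreal_leI simp: field_simps)
  then have "(INF R \<in> correspondences X Y. ?D R) \<le> ennreal (\<delta> / p_factor p)"
    using assms(1) by (rule INF_lower2[rotated])
  then have "GH_dist p X Y \<le> ennreal (p_factor p) * ennreal (\<delta> / p_factor p)"
    unfolding GH_dist_def p_factor_def[symmetric] by (rule mult_left_mono) simp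
  also have "\<dots> = ennreal \<delta>"
    using p_factor_pos[of p] by (simp flip: ennreal_mult')
  finally show ?thesis .
qed

text \<open>The infimum over correspondences need not be attained, so a strict bound is assumed.
  Moving \<open>p_factor p\<close> to the other side by division isolates the infimum, and some
  correspondence then stays below \<open>\<delta> / p_factor p\<close>.\<close>

lemma GH_dist_lessE:
  assumes "GH_dist p X Y < ennreal \<delta>" "0 < \<delta>"
  obtains R where "R \<in> correspondences X Y"
    "\<And>x y x' y'. (x, y) \<in> R \<Longrightarrow> (x', y') \<in> R \<Longrightarrow>
      p_factor p * p_diff p (mdist X x x') (mdist Y y y') \<le> \<delta>"
proof -
  let ?D = "\<lambda>R. SUP (x, y) \<in> R. SUP (x', y') \<in> R. ennreal (p_diff p (mdist X x x') (mdist Y y y'))"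
  have "\<not> ennreal (\<delta> / p_factor p) \<le> (INF R \<in> correspondences X Y. ?D R)"
  proof
    assume "ennreal (\<delta> / p_factor p) \<le> (INF R \<in> correspondences X Y. ?D R)"
    then have "ennreal (p_factor p) * ennreal (\<delta> / p_factor p) \<le> GH_dist p X Y"
      unfolding GH_dist_def p_factor_def[symmetric] by (rule mult_left_mono) simp
    moreover have "ennreal (p_factor p) * ennreal (\<delta> / p_factor p) = ennreal \<delta>"
      using p_factor_pos[of p] by (simp flip: ennreal_mult')
    ultimately show False using assms(1) by simp
  qed
  then obtain R where R: "R \<in> correspondences X Y" "?D R < ennreal (\<delta> / p_factor p)"
    by (auto simp: not_le INF_less_iff)
  show ?thesis
  proof (rule that[OF R(1)])
    fix x y x' y' assume "(x, y) \<in> R" "(x', y') \<in> R"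
    then have "ennreal (p_diff p (mdist X x x') (mdist Y y y')) \<le>
        (SUP (x', y') \<in> R. ennreal (p_diff p (mdist X x x') (mdist Y y y')))"
      by (intro SUP_upper2[of "(x', y')"]) auto
    also have "\<dots> \<le> ?D R"
      using \<open>(x, y) \<in> R\<close> by (intro SUP_upper2[of "(x, y)"]) auto
    also note R(2)
    finally have "p_diff p (mdist X x x') (mdist Y y y') < \<delta> / p_factor p"
      by (meson ennreal_leI not_le)
    then show "p_factor p * p_diff p (mdist X x x') (mdist Y y y') \<le> \<delta>"
      using p_factor_pos[of p] by (simp add: field_simps)
  qed
qed

section \<open>From a common ambient space to a correspondence\<close>

lemma GH_dist_le_hausdorff_dist:
  assumes p: "1 \<le> p" and Z: "p_metric_space p Z"
    and f: "isometric_embedding X Z f" and g: "isometric_embedding Y Z g"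
  shows "GH_dist p X Y \<le> hausdorff_dist Z (f ` mspace X) (g ` mspace Y)"
proof (rule dense_ge)
  fix u assume "hausdorff_dist Z (f ` mspace X) (g ` mspace Y) < u"
  \<comment> \<open>An intermediate \<open>h\<close> is finite even if \<open>u\<close> is not.
    Strictness below \<open>h\<close> yields partners at distance at most \<delta> without any
    attained infimum.\<close>
  then obtain h where h: "hausdorff_dist Z (f ` mspace X) (g ` mspace Y) < h" "h < u"
    using dense by blast
  then have "h \<noteq> top" by auto
  then obtain \<delta> where \<delta>: "h = ennreal \<delta>" "0 \<le> \<delta>"
    by (cases h) auto
  define R where "R = {(x, y). x \<in> mspace X \<and> y \<in> mspace Y \<and> mdist Z (f x) (g y) \<le> \<delta>}"
  have le: "mdist Z v w \<le> \<delta>" if "ennreal (mdist Z v w) < h" for v w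
    using that \<delta> by (simp add: ennreal_less_iff)
  have *: "(SUP a\<in>f ` mspace X. INF b\<in>g ` mspace Y. ennreal (mdist Z a b)) < h"
    "(SUP b\<in>g ` mspace Y. INF a\<in>f ` mspace X. ennreal (mdist Z a b)) < h"
    using h(1) by (auto simp: hausdorff_dist_def)
  have 1: "\<exists>y\<in>mspace Y. mdist Z (f x) (g y) \<le> \<delta>" if "x \<in> mspace X" for x
  proof -
    have "(INF b\<in>g ` mspace Y. ennreal (mdist Z (f x) b)) < h"
      by (rule le_less_trans[OF SUP_upper *(1)]) (use that in simp)
    then show ?thesis using le by (auto simp: INF_less_iff)
  qed
  have 2: "\<exists>x\<in>mspace X. mdist Z (f x) (g y) \<le> \<delta>" if "y \<in> mspace Y" for y
  proof -
    have "(INF a\<in>f ` mspace X. ennreal (mdist Z a (g y))) < h"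
      by (rule le_less_trans[OF SUP_upper *(2)]) (use that in simp)
    then show ?thesis using le by (auto simp: INF_less_iff)
  qed
  have R: "R \<in> correspondences X Y"
    using 1 2 by (force simp: correspondences_def R_def)
  \<comment> \<open>The path from \<open>a\<close> over \<open>c\<close> and \<open>e\<close> to
    \<open>b\<close> has two outer legs of length at most \<delta>. It serves for both halves of the
    distortion bound, with the roles of the two images exchanged.\<close>
  have tri: "mdist Z a b \<le> p_sum p (mdist Z c e) (p_sum p \<delta> \<delta>)"
    if "a \<in> mspace Z" "b \<in> mspace Z" "c \<in> mspace Z" "e \<in> mspace Z"
      "mdist Z a c \<le> \<delta>" "mdist Z e b \<le> \<delta>" for a b c e
  proof -
    have "mdist Z a b \<le> p_sum p (mdist Z a c) (mdist Z c b)"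
      using Z that by (auto simp: p_metric_space_def)
    also have "\<dots> \<le> p_sum p (mdist Z a c) (p_sum p (mdist Z c e) (mdist Z e b))"
      using Z that p by (intro p_sum_mono) (auto simp: p_metric_space_def)
    also have "\<dots> \<le> p_sum p \<delta> (p_sum p (mdist Z c e) \<delta>)"
      using that p by (intro p_sum_mono) auto
    also have "\<dots> = p_sum p (mdist Z c e) (p_sum p \<delta> \<delta>)"
      by (rule p_sum_left_commute[OF p])
    finally show ?thesis .
  qed
  have "GH_dist p X Y \<le> ennreal \<delta>"
  proof (rule GH_dist_le[OF R])
    fix x y x' y' assume xy: "(x, y) \<in> R" "(x', y') \<in> R"
    then have in_Z: "f x \<in> mspace Z" "f x' \<in> mspace Z" "g y \<in> mspace Z" "g y' \<in> mspace Z"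
      using f g by (auto simp: R_def isometric_embedding_def)
    have eq: "mdist X x x' = mdist Z (f x) (f x')" "mdist Y y y' = mdist Z (g y) (g y')"
      using f g xy by (auto simp: R_def isometric_embedding_def)
    show "p_factor p * p_diff p (mdist X x x') (mdist Y y y') \<le> \<delta>"
      using tri[of "f x" "f x'" "g y" "g y'"] tri[of "g y" "g y'" "f x" "f x'"] xy in_Z
      by (simp add: p_factor_p_diff_le_iff p \<delta>(2) eq R_def mdist_commute[of Z "g _" "f _"])
  qed
  also have "\<dots> \<le> u" using h(2) \<delta>(1) by (simp add: less_imp_le)
  finally show "GH_dist p X Y \<le> u" .
qed

section \<open>Compact unions, and the bridge distance across a correspondence\<close>

lemma compact_space_Un_isometric:
  assumes "compact_space (mtopology_of X)" "compact_space (mtopology_of Y)"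
    and "isometric_embedding X Z f" "isometric_embedding Y Z g"
    and Z: "mspace Z = f ` mspace X \<union> g ` mspace Y"
  shows "compact_space (mtopology_of Z)"
proof -
  have *: "compactin (mtopology_of Z) (h ` mspace W)"
    if "compact_space (mtopology_of W)" "isometric_embedding W Z h" for W :: "'d metric" and h
  proof (rule image_compactin)
    show "compactin (mtopology_of W) (mspace W)"
      using that(1) by (simp add: compact_space_def)
    \<comment> \<open>Isometric embeddings are Lipschitz with constant 1, so \<open>Z\<close> is a
      union of two continuous images of compact spaces.\<close>
    have "Lipschitz_continuous_map W Z h"
      using that(2) unfolding Lipschitz_continuous_map_def isometric_embedding_def
      by (metis mult_1 order_refl)
    then show "continuous_map (mtopology_of W) (mtopology_of Z) h"
      by (rule Lipschitz_continuous_imp_continuous_map)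
  qed
  from *[OF assms(1,3)] *[OF assms(2,4)] show ?thesis
    by (simp add: compact_space_def Z compactin_Un)
qed

lemma p_diff_commute: "p_diff p a b = p_diff p b a"
  by (simp add: p_diff_def max.commute abs_minus_commute)

lemma correspondences_converse: "R \<in> correspondences X Y \<Longrightarrow> R\<inverse> \<in> correspondences Y X"
  by (auto simp: correspondences_def simp flip: Domain_fst Range_snd)

text \<open>The cheapest way from \<open>x\<close> to \<open>y\<close> that crosses once, at a pair
  of \<open>R\<close>, for the price \<delta>. With \<delta> as the outermost summand, the lower
  bound \<delta> is immediate.\<close>

definition bridge :: "ennreal \<Rightarrow> real \<Rightarrow> 'a metric \<Rightarrow> 'b metric \<Rightarrow> ('a \<times> 'b) set \<Rightarrow> 'a \<Rightarrow> 'b \<Rightarrow> real" where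
  "bridge p \<delta> X Y R x y =
     (INF (x', y') \<in> R. p_sum p \<delta> (p_sum p (mdist X x x') (mdist Y y y')))"

lemma bridge_converse: "bridge p \<delta> Y X (R\<inverse>) y x = bridge p \<delta> X Y R x y"
proof -
  have "R\<inverse> = prod.swap ` R" by force
  then show ?thesis
    by (simp add: bridge_def image_image case_prod_unfold p_sum_commute[of p "mdist Y y _"])
qed

text \<open>Strict positivity of \<delta> keeps the copies of \<open>X\<close> and \<open>Y\<close>
  apart, so that gluing gives a metric and not only a pseudometric.\<close>

locale gluing =
  fixes p :: ennreal and \<delta> :: real and X :: "'a metric" and Y :: "'b metric" and R :: "('a \<times> 'b) set"
  assumes p: "1 \<le> p" and \<delta>: "0 < \<delta>"
    and X: "p_metric_space p X" and Y: "p_metric_space p Y"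
    and R: "R \<in> correspondences X Y"
    and distortion: "\<And>x y x' y'. (x, y) \<in> R \<Longrightarrow> (x', y') \<in> R \<Longrightarrow>
      p_factor p * p_diff p (mdist X x x') (mdist Y y y') \<le> \<delta>"
begin

text \<open>The situation is symmetric. Together with \<open>bridge_converse\<close>, this gives
  every fact about the \<open>X\<close> side also for the \<open>Y\<close> side, with the same
  bridge function.\<close>

lemma converse: "gluing p \<delta> Y X (R\<inverse>)"
  by unfold_locales
    (auto simp: p \<delta> X Y R correspondences_converse distortion p_diff_commute[of p "mdist Y _ _"])

lemma R_nonempty: "R \<noteq> {}"
  using R X by (auto simp: correspondences_def p_metric_space_def)

lemma R_mspace: "(x, y) \<in> R \<Longrightarrow> x \<in> mspace X \<and> y \<in> mspace Y"
  using R by (auto simp: correspondences_def)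

lemma bridge_le:
  assumes "(x', y') \<in> R"
  shows "bridge p \<delta> X Y R x y \<le> p_sum p \<delta> (p_sum p (mdist X x x') (mdist Y y y'))"
proof -
  have "bdd_below ((\<lambda>(x', y'). p_sum p \<delta> (p_sum p (mdist X x x') (mdist Y y y'))) ` R)"
    using \<delta> by (auto intro!: bdd_belowI[of _ 0])
  from cINF_lower[OF this assms] show ?thesis by (simp add: bridge_def)
qed

lemma le_bridge: "\<delta> \<le> bridge p \<delta> X Y R x y"
  unfolding bridge_def using R_nonempty \<delta> by (auto intro!: cINF_greatest p_sum_ge_left p)

lemma bridge_pair_le:
  assumes "(x, y) \<in> R"
  shows "bridge p \<delta> X Y R x y \<le> \<delta>"
proof -
  have "mdist X x x = 0" "mdist Y y y = 0" using R_mspace[OF assms] by auto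
  then show ?thesis using bridge_le[OF assms, of x y] \<delta> by (simp add: p_sum_0_right p)
qed

lemma le_p_sum_bridge:
  assumes "0 \<le> a"
    and "\<And>x' y'. (x', y') \<in> R \<Longrightarrow> c \<le> p_sum p a (p_sum p \<delta> (p_sum p (mdist X x x') (mdist Y y y')))"
  shows "c \<le> p_sum p a (bridge p \<delta> X Y R x y)"
  unfolding bridge_def using R_nonempty \<delta> assms p by (intro le_p_sum_Inf) auto

lemma triangle_X:
  assumes "x \<in> mspace X" "x' \<in> mspace X" "x'' \<in> mspace X"
  shows "mdist X x x'' \<le> p_sum p (mdist X x x') (mdist X x' x'')"
  using X assms by (auto simp: p_metric_space_def)

text \<open>Any crossing pair available from \<open>x2\<close> can also be used from
  \<open>x\<close>, by going to \<open>x2\<close> first.\<close>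

lemma bridge_triangle_left:
  assumes "x \<in> mspace X" "x2 \<in> mspace X"
  shows "bridge p \<delta> X Y R x y \<le> p_sum p (mdist X x x2) (bridge p \<delta> X Y R x2 y)"
proof (rule le_p_sum_bridge)
  fix x' y' assume R': "(x', y') \<in> R"
  have "bridge p \<delta> X Y R x y \<le> p_sum p \<delta> (p_sum p (mdist X x x') (mdist Y y y'))"
    using R' by (rule bridge_le)
  also have "\<dots> \<le> p_sum p \<delta> (p_sum p (p_sum p (mdist X x x2) (mdist X x2 x')) (mdist Y y y'))"
    using R_mspace[OF R'] assms \<delta> by (intro p_sum_mono p triangle_X) auto
  also have "\<dots> = p_sum p (mdist X x x2) (p_sum p \<delta> (p_sum p (mdist X x2 x') (mdist Y y y')))"
    by (simp add: p_sum_assoc p p_sum_left_commute[of p \<delta>])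
  finally show "bridge p \<delta> X Y R x y \<le> \<dots>" .
qed simp

text \<open>This is the case in which the distortion bound does the work: a route from
  \<open>x\<close> to \<open>y\<close> and back to \<open>x2\<close> crosses at two pairs of
  \<open>R\<close>, and the two crossings pay exactly for the difference between the distances of
  these pairs in \<open>X\<close> and in \<open>Y\<close>.\<close>

lemma bridge_triangle_over:
  assumes x: "x \<in> mspace X" "x2 \<in> mspace X" and y: "y \<in> mspace Y"
  shows "mdist X x x2 \<le> p_sum p (bridge p \<delta> X Y R x y) (bridge p \<delta> X Y R x2 y)"
proof (rule le_p_sum_bridge)
  show "0 \<le> bridge p \<delta> X Y R x y" using le_bridge[of x y] \<delta> by simp
next
  fix x'' y'' assume R'': "(x'', y'') \<in> R"
  let ?B = "p_sum p \<delta> (p_sum p (mdist X x2 x'') (mdist Y y y''))"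
  \<comment> \<open>The two infima are resolved one after the other: the crossing pair for
    \<open>x2\<close> is now fixed, and the one for \<open>x\<close> comes next.\<close>
  have "mdist X x x2 \<le> p_sum p ?B (bridge p \<delta> X Y R x y)"
  proof (rule le_p_sum_bridge)
    show "0 \<le> ?B" using \<delta> by simp
  next
    fix x' y' assume R': "(x', y') \<in> R"
    interpret conv: gluing p \<delta> Y X "R\<inverse>" by (rule converse)
    have "mdist X x' x'' \<le> p_sum p (mdist Y y' y'') (p_sum p \<delta> \<delta>)"
      using distortion[OF R' R''] \<delta> by (simp add: p_factor_p_diff_le_iff p)
    also have "\<dots> \<le> p_sum p (p_sum p (mdist Y y' y) (mdist Y y y'')) (p_sum p \<delta> \<delta>)"
      using \<delta> y R_mspace[OF R'] R_mspace[OF R''] by (intro p_sum_mono p conv.triangle_X) auto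
    finally have *: "mdist X x' x'' \<le> \<dots>" .
    have "mdist X x x2 \<le> p_sum p (mdist X x x') (mdist X x' x2)"
      using x R_mspace[OF R'] by (intro triangle_X) auto
    also have "\<dots> \<le> p_sum p (mdist X x x') (p_sum p (mdist X x' x'') (mdist X x'' x2))"
      using x R_mspace[OF R'] R_mspace[OF R''] by (intro p_sum_mono p triangle_X) auto
    also have "\<dots> \<le> p_sum p (mdist X x x') (p_sum p
        (p_sum p (p_sum p (mdist Y y' y) (mdist Y y y'')) (p_sum p \<delta> \<delta>)) (mdist X x'' x2))"
      using * by (intro p_sum_mono p) auto
    \<comment> \<open>Both sides have the same six summands; each of the two bridges receives one
      \<delta>.\<close>
    also have "\<dots> = p_sum p ?B (p_sum p \<delta> (p_sum p (mdist X x x') (mdist Y y y')))"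
      by (simp add: p_sum_assoc p p_sum_left_commute p_sum_commute mdist_commute)
    finally show "mdist X x x2 \<le> \<dots>" .
  qed
  then show "mdist X x x2 \<le> p_sum p (bridge p \<delta> X Y R x y) ?B"
    by (simp add: p_sum_commute)
qed

end

section \<open>The glued metric space\<close>

fun glue_dist :: "ennreal \<Rightarrow> real \<Rightarrow> 'a metric \<Rightarrow> 'b metric \<Rightarrow> ('a \<times> 'b) set \<Rightarrow>
    'a + 'b + 'z \<Rightarrow> 'a + 'b + 'z \<Rightarrow> real" where
  "glue_dist p \<delta> X Y R (Inl x) (Inl x') = mdist X x x'"
| "glue_dist p \<delta> X Y R (Inl x) (Inr (Inl y)) = bridge p \<delta> X Y R x y"
| "glue_dist p \<delta> X Y R (Inr (Inl y)) (Inl x) = bridge p \<delta> X Y R x y"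
| "glue_dist p \<delta> X Y R (Inr (Inl y)) (Inr (Inl y')) = mdist Y y y'"
| "glue_dist p \<delta> X Y R _ _ = 0"

definition glue_space :: "'a metric \<Rightarrow> 'b metric \<Rightarrow> ('a + 'b + 'z) set" where
  "glue_space X Y = Inl ` mspace X \<union> (Inr \<circ> Inl) ` mspace Y"

context gluing
begin

text \<open>There are eight cases, according to the sides of the three points. Three points on one
  side use the given p-metrics; a middle point opposite two others uses
  \<open>bridge_triangle_over\<close>; the remaining cases prolong a bridge within one side.\<close>

lemma glue_p_triangle:
  assumes "u \<in> glue_space X Y" "v \<in> glue_space X Y" "w \<in> glue_space X Y"
  shows "glue_dist p \<delta> X Y R u w \<le> p_sum p (glue_dist p \<delta> X Y R u v) (glue_dist p \<delta> X Y R v w)"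
proof -
  interpret conv: gluing p \<delta> Y X "R\<inverse>" by (rule converse)
  have right_X: "bridge p \<delta> X Y R x y \<le> p_sum p (bridge p \<delta> X Y R x2 y) (mdist X x2 x)"
    if "x \<in> mspace X" "x2 \<in> mspace X" for x x2 y
    by (subst p_sum_commute) (simp only: mdist_commute[of X x2 x] bridge_triangle_left that)
  have right_Y: "bridge p \<delta> X Y R x y \<le> p_sum p (bridge p \<delta> X Y R x y2) (mdist Y y2 y)"
    if "y \<in> mspace Y" "y2 \<in> mspace Y" for x y y2
    by (subst p_sum_commute) (simp only: mdist_commute[of Y y2 y]
        conv.bridge_triangle_left[unfolded bridge_converse] that)
  show ?thesis
    using assms unfolding glue_space_def
    by (elim UnE imageE) (simp_all add: triangle_X conv.triangle_X right_X right_Y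
        bridge_triangle_left bridge_triangle_over
        conv.bridge_triangle_left[unfolded bridge_converse]
        conv.bridge_triangle_over[unfolded bridge_converse])
qed

text \<open>\<open>Metric_space\<close> demands nonnegativity and symmetry on the whole type, also
  outside the carrier. The default value 0 of \<open>glue_dist\<close> takes care of the points from
  the third summand.\<close>

lemma glue_dist_nonneg: "0 \<le> glue_dist p \<delta> X Y R u v"
  using order_trans[OF less_imp_le[OF \<delta>] le_bridge]
  by (cases "(p, \<delta>, X, Y, R, u, v)" rule: glue_dist.cases) auto

lemma glue_dist_commute: "glue_dist p \<delta> X Y R u v = glue_dist p \<delta> X Y R v u"
  by (cases "(p, \<delta>, X, Y, R, u, v)" rule: glue_dist.cases) (auto simp: mdist_commute)

lemma glue_Metric_space:
  "Metric_space (glue_space X Y :: ('a + 'b + 'z) set) (glue_dist p \<delta> X Y R)"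
proof
  fix u v :: "'a + 'b + 'z" assume "u \<in> glue_space X Y" "v \<in> glue_space X Y"
  then show "glue_dist p \<delta> X Y R u v = 0 \<longleftrightarrow> u = v"
    \<comment> \<open>Distances across the two sides are at least \<delta>, hence never 0.\<close>
    using less_le_trans[OF \<delta> le_bridge, THEN less_imp_neq, symmetric]
    by (auto simp: glue_space_def)
next
  fix u v w :: "'a + 'b + 'z" assume "u \<in> glue_space X Y" "v \<in> glue_space X Y" "w \<in> glue_space X Y"
  then show "glue_dist p \<delta> X Y R u w \<le> glue_dist p \<delta> X Y R u v + glue_dist p \<delta> X Y R v w"
    by (rule order_trans[OF glue_p_triangle p_sum_le_add[OF p glue_dist_nonneg glue_dist_nonneg]])
qed (fact glue_dist_nonneg glue_dist_commute)+

definition glue :: "('a + 'b + 'z) metric" where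
  "glue = metric (glue_space X Y, glue_dist p \<delta> X Y R)"

lemma mspace_glue: "mspace glue = glue_space X Y"
  and mdist_glue: "mdist glue = glue_dist p \<delta> X Y R"
  unfolding glue_def
  by (simp_all add: Metric_space.mspace_metric Metric_space.mdist_metric glue_Metric_space)

lemma glue_embeddings:
  assumes "compact_space (mtopology_of X)" "compact_space (mtopology_of Y)"
  shows "(glue, Inl, Inr \<circ> Inl) \<in> common_embeddings p X Y"
proof -
  have emb: "isometric_embedding X glue Inl" "isometric_embedding Y glue (Inr \<circ> Inl)"
    by (auto simp: isometric_embedding_def mspace_glue mdist_glue glue_space_def)
  have "compact_space (mtopology_of (glue :: ('a + 'b + 'z) metric))"
    by (rule compact_space_Un_isometric[OF assms emb]) (simp add: mspace_glue glue_space_def)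
  moreover have "glue_space X Y \<noteq> {}"
    using X by (auto simp: glue_space_def p_metric_space_def)
  then have "p_metric_space p glue"
    by (simp add: p_metric_space_def mspace_glue mdist_glue glue_p_triangle)
  ultimately show ?thesis
    using emb by (simp add: common_embeddings_def compact_p_metric_space_def)
qed

lemma hausdorff_dist_glue:
  "hausdorff_dist (glue :: ('a + 'b + 'z) metric) (Inl ` mspace X) ((Inr \<circ> Inl) ` mspace Y)
    \<le> ennreal \<delta>" (is "hausdorff_dist ?G _ _ \<le> _")
proof -
  have X_le: "(INF b\<in>(Inr \<circ> Inl) ` mspace Y. ennreal (mdist ?G (Inl x) b)) \<le> ennreal \<delta>"
    if x: "x \<in> mspace X" for x
  proof -
    \<comment> \<open>A partner under \<open>R\<close> is enough, since the bridge over a pair of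
      \<open>R\<close> has length at most \<delta>.\<close>
    obtain y where "(x, y) \<in> R" using x R by (force simp: correspondences_def)
    then show ?thesis
      by (intro INF_lower2[of "(Inr \<circ> Inl) y"])
        (auto simp: mdist_glue R_mspace intro: ennreal_leI bridge_pair_le)
  qed
  have Y_le: "(INF a\<in>Inl ` mspace X. ennreal (mdist ?G a (Inr (Inl y)))) \<le> ennreal \<delta>"
    if y: "y \<in> mspace Y" for y
  proof -
    obtain x where "(x, y) \<in> R" using y R by (force simp: correspondences_def)
    then show ?thesis
      by (intro INF_lower2[of "Inl x"])
        (auto simp: mdist_glue R_mspace intro: ennreal_leI bridge_pair_le)
  qed
  show ?thesis
    unfolding hausdorff_dist_def
  proof (rule max.boundedI)
    show "(SUP a\<in>Inl ` mspace X. INF b\<in>(Inr \<circ> Inl) ` mspace Y. ennreal (mdist ?G a b)) \<le> ennreal \<delta>"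
      using X_le by (intro SUP_least) (erule imageE, simp only:)
    show "(SUP b\<in>(Inr \<circ> Inl) ` mspace Y. INF a\<in>Inl ` mspace X. ennreal (mdist ?G a b)) \<le> ennreal \<delta>"
      using Y_le by (intro SUP_least) (erule imageE, simp only: o_apply)
  qed
qed

end

section \<open>The two inequalities between the distance and the infimum\<close>

theorem theorem4p4:
  fixes p :: ennreal and X :: "'a metric" and Y :: "'b metric"
  assumes "1 \<le> p"
    and "compact_p_metric_space p X"
    and "compact_p_metric_space p Y"
  shows "GH_dist p X Y =
    (INF (Z, f, g) \<in> (common_embeddings p X Y ::
        (('a + 'b + 'z) metric \<times> ('a \<Rightarrow> 'a + 'b + 'z) \<times> ('b \<Rightarrow> 'a + 'b + 'z)) set).
      hausdorff_dist Z (f ` mspace X) (g ` mspace Y))"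
    (is "_ = ?I")
proof (rule antisym)
  show "GH_dist p X Y \<le> ?I"
  proof (rule INF_greatest, clarify)
    fix Z :: "('a + 'b + 'z) metric" and f g
    assume "(Z, f, g) \<in> common_embeddings p X Y"
    then show "GH_dist p X Y \<le> hausdorff_dist Z (f ` mspace X) (g ` mspace Y)"
      by (intro GH_dist_le_hausdorff_dist assms(1))
        (simp_all add: common_embeddings_def compact_p_metric_space_def)
  qed
next
  show "?I \<le> GH_dist p X Y"
  proof (rule dense_ge)
    fix u assume "GH_dist p X Y < u"
    then obtain h where h: "GH_dist p X Y < h" "h < u"
      using dense by blast
    have "h \<noteq> top" using h(2) by auto
    \<comment> \<open>Choosing \<open>h\<close> strictly above the distance makes \<delta> positive
      even when the distance is 0, as the gluing requires.\<close>
    moreover have "0 < h" by (rule le_less_trans[OF zero_le h(1)])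
    ultimately obtain \<delta> where h_eq: "h = ennreal \<delta>" "0 < \<delta>"
      by (cases h) auto
    obtain R where "gluing p \<delta> X Y R"
    proof (rule GH_dist_lessE[OF h(1)[unfolded h_eq(1)] h_eq(2)])
      fix R assume "R \<in> correspondences X Y"
        "\<And>x y x' y'. (x, y) \<in> R \<Longrightarrow> (x', y') \<in> R \<Longrightarrow>
          p_factor p * p_diff p (mdist X x x') (mdist Y y y') \<le> \<delta>"
      with assms h_eq(2) have "gluing p \<delta> X Y R"
        by (simp add: gluing_def compact_p_metric_space_def)
      then show thesis by (rule that)
    qed
    then interpret gluing p \<delta> X Y R .
    have compact: "compact_space (mtopology_of X)" "compact_space (mtopology_of Y)"
      using assms by (simp_all add: compact_p_metric_space_def)
    have "?I \<le> hausdorff_dist (glue :: ('a + 'b + 'z) metric) (Inl ` mspace X) ((Inr \<circ> Inl) ` mspace Y)"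
      by (rule INF_lower2[OF glue_embeddings[OF compact]]) (simp only: prod.case order_refl)
    also have "\<dots> \<le> h" unfolding h_eq(1) by (rule hausdorff_dist_glue)
    also have "\<dots> \<le> u" using h(2) by (rule less_imp_le)
    finally show "?I \<le> u" .
  qed
qed

end
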